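(* Let $(X,\cdot)$ be a right P{\l}onka magma. Then: (1) The map $R=R_{(\cdot,\cdot_{\rm op})}:X\times X\to X\times X$, $R(x,y)=(x\cdot y,\ y\cdot x)$, is a solution of the set-theoretic Yang--Baxter equation. (2) $R$ is unitary if and only if $(X,\cdot)$ is a right involutory magma. (3) $R$ is unitary and diagonal if and only if $(X,\cdot)$ is a $2$-cyclic magma.
   Context: A right P{\l}onka magma is a set $X$ with a binary operation such that $(x\cdot y)\cdot z=(x\cdot z)\cdot y$ and $x\cdot(y\cdot z)=x\cdot y$ for all $x,y,z\in X$. A magma is right involutory if $(x\cdot y)\cdot y=x$ for all $x,y$. A $2$-cyclic magma is a right P{\l}onka magma which is right involutory and satisfies $x\cdot x=x$ for all $x$. A map $R:X\times X\to X\times X$ is a solution of the Yang--Baxter equation if $R^{12}R^{13}R^{23}=R^{23}R^{13}R^{12}$ on $X^3$, where $R^{ij}$ acts as $R$ on coordinates $i,j$ and as the identity on the remaining one. With $\tau_X(x,y)=(y,x)$ and $R^{21}=\tau_XR\,\tau_X$, $R$ is unitary if $R^{21}R=\mathrm{Id}_{X\times X}$. $R$ is diagonal if $R(x,x)=(x,x)$ for all $x\in X$. *)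

theory Defs
  imports "HOL-Library.FuncSet"
begin

text \<open>
  Magmas and maps live on a carrier set \<open>X\<close> (possibly empty); operations and maps are HOL
  functions on the whole type, of which only the values on \<open>X\<close> matter.
\<close>

definition magma :: "'a set \<Rightarrow> ('a \<Rightarrow> 'a \<Rightarrow> 'a) \<Rightarrow> bool" where
  "magma X m \<longleftrightarrow> m \<in> X \<rightarrow> X \<rightarrow> X"

definition right_plonka_magma :: "'a set \<Rightarrow> ('a \<Rightarrow> 'a \<Rightarrow> 'a) \<Rightarrow> bool" where
  "right_plonka_magma X m \<longleftrightarrow> magma X m \<and>
     (\<forall>x\<in>X. \<forall>y\<in>X. \<forall>z\<in>X. m (m x y) z = m (m x z) y) \<and>
     (\<forall>x\<in>X. \<forall>y\<in>X. \<forall>z\<in>X. m x (m y z) = m x y)"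

definition right_involutory_magma :: "'a set \<Rightarrow> ('a \<Rightarrow> 'a \<Rightarrow> 'a) \<Rightarrow> bool" where
  "right_involutory_magma X m \<longleftrightarrow> magma X m \<and> (\<forall>x\<in>X. \<forall>y\<in>X. m (m x y) y = x)"

definition two_cyclic_magma :: "'a set \<Rightarrow> ('a \<Rightarrow> 'a \<Rightarrow> 'a) \<Rightarrow> bool" where
  "two_cyclic_magma X m \<longleftrightarrow>
     right_plonka_magma X m \<and> right_involutory_magma X m \<and> (\<forall>x\<in>X. m x x = x)"

definition act12 :: "('a \<times> 'a \<Rightarrow> 'a \<times> 'a) \<Rightarrow> 'a \<times> 'a \<times> 'a \<Rightarrow> 'a \<times> 'a \<times> 'a" where
  "act12 R = (\<lambda>(x, y, z). case R (x, y) of (a, b) \<Rightarrow> (a, b, z))"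

definition act13 :: "('a \<times> 'a \<Rightarrow> 'a \<times> 'a) \<Rightarrow> 'a \<times> 'a \<times> 'a \<Rightarrow> 'a \<times> 'a \<times> 'a" where
  "act13 R = (\<lambda>(x, y, z). case R (x, z) of (a, c) \<Rightarrow> (a, y, c))"

definition act23 :: "('a \<times> 'a \<Rightarrow> 'a \<times> 'a) \<Rightarrow> 'a \<times> 'a \<times> 'a \<Rightarrow> 'a \<times> 'a \<times> 'a" where
  "act23 R = (\<lambda>(x, y, z). case R (y, z) of (b, c) \<Rightarrow> (x, b, c))"

definition ybe_solution :: "'a set \<Rightarrow> ('a \<times> 'a \<Rightarrow> 'a \<times> 'a) \<Rightarrow> bool" where
  "ybe_solution X R \<longleftrightarrow> R \<in> X \<times> X \<rightarrow> X \<times> X \<and>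
     (\<forall>t \<in> X \<times> X \<times> X. (act12 R \<circ> act13 R \<circ> act23 R) t = (act23 R \<circ> act13 R \<circ> act12 R) t)"

definition map21 :: "('a \<times> 'a \<Rightarrow> 'a \<times> 'a) \<Rightarrow> 'a \<times> 'a \<Rightarrow> 'a \<times> 'a" where
  "map21 R = prod.swap \<circ> R \<circ> prod.swap"

definition unitary :: "'a set \<Rightarrow> ('a \<times> 'a \<Rightarrow> 'a \<times> 'a) \<Rightarrow> bool" where
  "unitary X R \<longleftrightarrow> (\<forall>p \<in> X \<times> X. (map21 R \<circ> R) p = p)"

definition diagonal :: "'a set \<Rightarrow> ('a \<times> 'a \<Rightarrow> 'a \<times> 'a) \<Rightarrow> bool" where
  "diagonal X R \<longleftrightarrow> (\<forall>x\<in>X. R (x, x) = (x, x))"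

definition op_map :: "('a \<Rightarrow> 'a \<Rightarrow> 'a) \<Rightarrow> 'a \<times> 'a \<Rightarrow> 'a \<times> 'a" where
  "op_map m = (\<lambda>(x, y). (m x y, m y x))"

end

theory Submission
  imports Defs
begin

text \<open>
  Since \<open>x \<cdot> (y \<cdot> z) = x \<cdot> y\<close>, right factors may be replaced by their left-most entry. Both sides of
  the Yang--Baxter equation at \<open>(x, y, z)\<close> then become
  \<open>((x \<cdot> y) \<cdot> z, (y \<cdot> x) \<cdot> z, (z \<cdot> x) \<cdot> y)\<close> up to right commutativity, and \<open>R\<^sup>2\<^sup>1 R\<close> sends \<open>(x, y)\<close> to
  \<open>((x \<cdot> y) \<cdot> y, (y \<cdot> x) \<cdot> x)\<close>.
\<close>

lemma
  assumes "right_plonka_magma X m"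
  shows right_plonka_magma_magma: "magma X m"
    and right_plonka_magma_closed: "\<lbrakk>x \<in> X; y \<in> X\<rbrakk> \<Longrightarrow> m x y \<in> X"
    and right_plonka_magma_right_commute:
      "\<lbrakk>x \<in> X; y \<in> X; z \<in> X\<rbrakk> \<Longrightarrow> m (m x y) z = m (m x z) y"
    and right_plonka_magma_absorb: "\<lbrakk>x \<in> X; y \<in> X; z \<in> X\<rbrakk> \<Longrightarrow> m x (m y z) = m x y"
  using assms by (auto simp: right_plonka_magma_def magma_def)

lemma ybe_solution_op_map:
  assumes "right_plonka_magma X m"
  shows "ybe_solution X (op_map m)"
proof -
  note [simp] = right_plonka_magma_closed[OF assms] right_plonka_magma_absorb[OF assms]
  have "(act12 (op_map m) \<circ> act13 (op_map m) \<circ> act23 (op_map m)) (x, y, z) =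
      (act23 (op_map m) \<circ> act13 (op_map m) \<circ> act12 (op_map m)) (x, y, z)"
    if "x \<in> X" "y \<in> X" "z \<in> X" for x y z
    using that
    \<comment> \<open>After absorption, right commutativity acts as an ordered rewrite rule that
      sorts the right factors in each component.\<close>
    by (simp add: act12_def act13_def act23_def op_map_def right_plonka_magma_right_commute[OF assms])
  then show ?thesis
    by (auto simp: ybe_solution_def op_map_def)
qed

lemma unitary_op_map_iff:
  assumes "right_plonka_magma X m"
  shows "unitary X (op_map m) \<longleftrightarrow> right_involutory_magma X m"
proof -
  have "(map21 (op_map m) \<circ> op_map m) (x, y) = (m (m x y) y, m (m y x) x)"
    if "x \<in> X" "y \<in> X" for x y
    using that
    by (simp add: map21_def op_map_def right_plonka_magma_closed[OF assms]
        right_plonka_magma_absorb[OF assms])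
  \<comment> \<open>The components differ by exchanging \<open>x\<close> and \<open>y\<close>, so
    over all pairs they give a single condition. Without \<open>o_apply\<close> the composition
    keeps the form just computed.\<close>
  then show ?thesis
    using right_plonka_magma_magma[OF assms]
    by (auto simp: unitary_def right_involutory_magma_def simp del: o_apply)
qed

lemma diagonal_op_map_iff: "diagonal X (op_map m) \<longleftrightarrow> (\<forall>x\<in>X. m x x = x)"
  by (simp add: diagonal_def op_map_def)

theorem corollary3p12:
  fixes X :: "'a set" and m :: "'a \<Rightarrow> 'a \<Rightarrow> 'a"
  assumes "right_plonka_magma X m"
  shows "ybe_solution X (op_map m) \<and>
    (unitary X (op_map m) \<longleftrightarrow> right_involutory_magma X m) \<and>
    (unitary X (op_map m) \<and> diagonal X (op_map m) \<longleftrightarrow> two_cyclic_magma X m)"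
  \<comment> \<open>The assumption is the first clause of \<open>two_cyclic_magma\<close>; unitarity
    and diagonality give the other two.\<close>
  using assms
  by (simp add: ybe_solution_op_map unitary_op_map_iff two_cyclic_magma_def diagonal_op_map_iff)

end
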